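(* Let $l\geq 1$ be an integer, and let $k=(k_1,\dots,k_l)$ and $n=(n_1,\dots,n_l)$ be elements of $\mathbb{Z}^l$ with $k_1>\dots>k_l$ and $n_1>\dots>n_l$. For $x\in\mathbb{R}$ let $f_{k,n}(x)=\det\big(I_{k_j-n_i}(x)\big)_{i,j=1,\dots,l}$, where $I_m$ ($m\in\mathbb{Z}$) denotes the modified Bessel function of the first kind. Then $f_{k,n}(x)>0$ for every $x>0$.
   Context: For $j\in\mathbb{Z}$ the modified Bessel functions of the first kind $I_j(x)$ are the Laurent coefficients in $e^{\frac{x}{2}(z+\frac1z)}=\sum_{j=-\infty}^{+\infty}I_j(x)z^j$; equivalently, $I_j(x)=\frac1\pi\int_0^\pi e^{x\cos\phi}\cos(j\phi)\,d\phi$. In the matrix $\big(I_{k_j-n_i}(x)\big)_{i,j}$, $i$ is the row index and $j$ is the column index. *)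

theory Defs
  imports "HOL-Analysis.Analysis" "Jordan_Normal_Form.Determinant"
begin

definition bessel_I :: "int \<Rightarrow> real \<Rightarrow> real" where
  "bessel_I j x = 1 / pi * integral {0..pi} (\<lambda>\<phi>. exp (x * cos \<phi>) * cos (real_of_int j * \<phi>))"

text \<open>
  The integral is one of two equivalent descriptions of the modified Bessel functions; the other
  one, as Laurent coefficients of $e^{x/2 (z + 1/z)}$, is \<open>bessel_I_generating_function\<close> below.
\<close>

context
  fixes x :: real
begin

private definition W :: "nat \<times> nat \<Rightarrow> real" where
  "W = (\<lambda>(p, q). (x / 2) ^ (p + q) / (fact p * fact q))"

private definition A :: "int \<Rightarrow> (nat \<times> nat) set" where
  "A j = {(p, q). int p - int q = j}"

private definition C :: "int \<Rightarrow> real" where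
  "C j = infsum W (A j)"

private lemma exp_has_sum:
  fixes y :: "'a :: {banach, real_normed_field}"
  shows "((\<lambda>n. y ^ n / fact n) has_sum exp y) UNIV"
proof -
  have "((\<lambda>n. y ^ n /\<^sub>R fact n) has_sum exp y) UNIV"
    by (rule norm_summable_imp_has_sum[OF summable_norm_exp exp_converges])
  then show ?thesis
    by (simp add: scaleR_conv_of_real field_simps)
qed

private lemma exp_prod_has_sum:
  fixes u v :: complex
  shows "((\<lambda>(p, q). u ^ p / fact p * (v ^ q / fact q)) has_sum (exp u * exp v)) (UNIV \<times> UNIV)"
    and "(\<lambda>(p, q). norm (u ^ p / fact p * (v ^ q / fact q))) summable_on (UNIV \<times> UNIV)"
proof -
  have "((\<lambda>q. norm u ^ p / fact p * (norm v ^ q / fact q)) has_sum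
          (norm u ^ p / fact p * exp (norm v))) UNIV" for p
    by (intro has_sum_cmult_right exp_has_sum)
  moreover have "(\<lambda>p. norm u ^ p / fact p * exp (norm v)) summable_on UNIV"
    by (intro summable_on_cmult_left has_sum_imp_summable[OF exp_has_sum])
  ultimately have "(\<lambda>(p, q). norm u ^ p / fact p * (norm v ^ q / fact q)) summable_on (UNIV \<times> UNIV)"
    by (intro summable_on_SigmaI[where g = "\<lambda>p. norm u ^ p / fact p * exp (norm v)"]) auto
  then show *: "(\<lambda>(p, q). norm (u ^ p / fact p * (v ^ q / fact q))) summable_on (UNIV \<times> UNIV)"
    by (simp add: norm_mult norm_divide norm_power)
  then have "(\<lambda>pq. norm (case pq of (p, q) \<Rightarrow> u ^ p / fact p * (v ^ q / fact q)))
      summable_on (UNIV \<times> UNIV)"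
    by (simp add: case_prod_unfold)
  then have "(\<lambda>(p, q). u ^ p / fact p * (v ^ q / fact q)) summable_on (UNIV \<times> UNIV)"
    by (rule abs_summable_summable)
  then show "((\<lambda>(p, q). u ^ p / fact p * (v ^ q / fact q)) has_sum (exp u * exp v)) (UNIV \<times> UNIV)"
  proof (rule has_sum_SigmaI[rotated 2])
    show "((\<lambda>q. case (p, q) of (p, q) \<Rightarrow> u ^ p / fact p * (v ^ q / fact q)) has_sum
            (u ^ p / fact p * exp v)) UNIV" for p
      unfolding prod.case by (rule has_sum_cmult_right[OF exp_has_sum])
    show "((\<lambda>p. u ^ p / fact p * exp v) has_sum (exp u * exp v)) UNIV"
      by (rule has_sum_cmult_left[OF exp_has_sum])
  qed
qed

private lemma W_abs_summable: "(\<lambda>pq. \<bar>W pq\<bar>) summable_on UNIV"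
  using exp_prod_has_sum(2)[of "of_real (x / 2)" "of_real (x / 2)"]
  by (simp add: W_def case_prod_unfold norm_mult norm_divide norm_power power_add
        abs_mult power_abs abs_divide)

private lemma W_summable: "W summable_on B"
  using W_abs_summable by (intro summable_on_subset_banach[OF abs_summable_summable[of W UNIV]]) auto

private lemma C_has_sum: "(W has_sum C j) (A j)"
  unfolding C_def using W_summable by (rule has_sum_infsum)

private lemma reindex:
  "(f has_sum s) (UNIV \<times> UNIV) \<longleftrightarrow> ((\<lambda>(j, pq). f pq) has_sum s) (Sigma UNIV A)"
  by (rule has_sum_reindex_bij_witness[of _ snd "\<lambda>(p, q). (int p - int q, (p, q))"])
     (auto simp: A_def)

private lemma C_abs_summable: "(\<lambda>j. \<bar>C j\<bar>) summable_on UNIV"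
proof -
  have *: "(\<lambda>pq. \<bar>W pq\<bar>) summable_on B" for B
    using W_abs_summable by (rule summable_on_subset_banach) auto
  have "((\<lambda>pq. \<bar>W pq\<bar>) has_sum infsum (\<lambda>pq. \<bar>W pq\<bar>) UNIV) (UNIV \<times> UNIV)"
    using W_abs_summable by simp
  then have "((\<lambda>j. infsum (\<lambda>pq. \<bar>W pq\<bar>) (A j)) has_sum infsum (\<lambda>pq. \<bar>W pq\<bar>) UNIV) UNIV"
    unfolding reindex by (rule has_sum_SigmaD) (use * in auto)
  then have s: "(\<lambda>j. infsum (\<lambda>pq. \<bar>W pq\<bar>) (A j)) summable_on UNIV"
    by (rule has_sum_imp_summable)
  have "\<bar>C j\<bar> \<le> infsum (\<lambda>pq. \<bar>W pq\<bar>) (A j)" for j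
    unfolding C_def using norm_infsum_bound[of W "A j"] *[of "A j"] by simp
  then show ?thesis
    using summable_on_comparison_test[OF s, of "\<lambda>j. \<bar>C j\<bar>"] by simp
qed

private lemma C_uminus: "C (- j) = C j"
  unfolding C_def
  by (rule infsum_reindex_bij_witness[of _ prod.swap prod.swap])
     (auto simp: A_def W_def add.commute mult.commute)

private lemma C_generating:
  fixes z :: complex
  assumes "z \<noteq> 0"
  shows "((\<lambda>j. of_real (C j) * z powi j) has_sum exp (of_real x / 2 * (z + 1 / z))) UNIV"
proof -
  let ?F = "\<lambda>(p, q). (of_real (x / 2) * z) ^ p / fact p * ((of_real (x / 2) / z) ^ q / fact q)"
  have "(?F has_sum exp (of_real x / 2 * (z + 1 / z))) (UNIV \<times> UNIV)"
  proof -
    have "of_real x / 2 * (z + 1 / z) = of_real (x / 2) * z + of_real (x / 2) / z"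
      by (simp add: field_simps)
    then show ?thesis
      using exp_prod_has_sum(1)[of "of_real (x / 2) * z" "of_real (x / 2) / z"]
      by (simp only: exp_add)
  qed
  then have *: "((\<lambda>(j, pq). ?F pq) has_sum exp (of_real x / 2 * (z + 1 / z))) (Sigma UNIV A)"
    unfolding reindex .
  have F: "?F pq = of_real (W pq) * z powi j" if pq: "pq \<in> A j" for pq j
  proof -
    obtain p q where [simp]: "pq = (p, q)"
      by fastforce
    have "j = int p - int q"
      using pq by (simp add: A_def)
    then have "z powi j = z ^ p / z ^ q"
      using assms by (simp add: power_int_diff)
    then show ?thesis
      by (simp add: W_def power_add power_divide power_mult_distrib mult_ac)
  qed
  have "(?F has_sum (of_real (C j) * z powi j)) (A j)" for j
  proof -
    have "((\<lambda>pq. of_real (W pq) * z powi j) has_sum (of_real (C j) * z powi j)) (A j)"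
      by (intro has_sum_cmult_left has_sum_of_real C_has_sum)
    then show ?thesis
      using F by (subst has_sum_cong[where g = "\<lambda>pq. of_real (W pq) * z powi j"]) auto
  qed
  then show ?thesis
    using has_sum_SigmaD[OF *, of "\<lambda>j. of_real (C j) * z powi j"] by simp
qed

private lemma C_cos: "((\<lambda>m. C m * cos (real_of_int m * \<phi>)) has_sum exp (x * cos \<phi>)) UNIV"
proof -
  have p: "cis \<phi> powi m = cis (real_of_int m * \<phi>)" for m
    by (simp add: cis_power_int)
  have "1 / cis \<phi> = cis (- \<phi>)"
    by (simp add: cis_divide[of 0 \<phi>, simplified])
  then have "of_real x / 2 * (cis \<phi> + 1 / cis \<phi>) = of_real (x * cos \<phi>)"
    by (simp add: complex_eq_iff)
  then have "((\<lambda>m. of_real (C m) * cis (real_of_int m * \<phi>)) has_sum of_real (exp (x * cos \<phi>))) UNIV"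
    using C_generating[of "cis \<phi>"] by (simp only: p cis_neq_zero not_False_eq_True exp_of_real simp_thms)
  from has_sum_Re[OF this] show ?thesis
    by simp
qed

private lemma cos_integral:
  "((\<lambda>\<phi>. cos (real_of_int n * \<phi>)) has_integral (if n = 0 then pi else 0)) {0..pi}"
proof (cases "n = 0")
  case True
  then show ?thesis using has_integral_const_real[of "1::real" 0 pi] by simp
next
  case False
  have "((\<lambda>\<phi>. cos (real_of_int n * \<phi>)) has_integral
          (sin (real_of_int n * pi) / n - sin (real_of_int n * 0) / n)) {0..pi}"
    using False
    by (intro fundamental_theorem_of_calculus)
       (auto intro!: derivative_eq_intros simp flip: has_real_derivative_iff_has_vector_derivative)
  then show ?thesis
    using False sin_npi_int[of n] by (simp add: mult.commute)
qed

private lemma cos_cos_integral: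
  "((\<lambda>\<phi>. C m * cos (real_of_int m * \<phi>) * cos (real_of_int j * \<phi>)) has_integral
     (pi / 2 * C j * ((if m = j then 1 else 0) + (if m = - j then 1 else 0)))) {0..pi}"
proof -
  have "((\<lambda>\<phi>. C m / 2 * (cos (real_of_int (m - j) * \<phi>) + cos (real_of_int (m + j) * \<phi>)))
          has_integral (C m / 2 * ((if m - j = 0 then pi else 0) + (if m + j = 0 then pi else 0)))) {0..pi}"
    by (intro has_integral_mult_right has_integral_add cos_integral)
  also have "C m / 2 * ((if m - j = 0 then pi else 0) + (if m + j = 0 then pi else 0)) =
      pi / 2 * C j * ((if m = j then 1 else 0) + (if m = - j then 1 else 0))"
    using C_uminus[of j] by (cases "m = - j") (auto simp: add_eq_0_iff2 field_simps)
  finally have *: "((\<lambda>\<phi>. C m / 2 * (cos (real_of_int (m - j) * \<phi>) + cos (real_of_int (m + j) * \<phi>)))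
      has_integral (pi / 2 * C j * ((if m = j then 1 else 0) + (if m = - j then 1 else 0)))) {0..pi}" .
  have **: "C m / 2 * (cos (real_of_int (m - j) * \<phi>) + cos (real_of_int (m + j) * \<phi>)) =
      C m * cos (real_of_int m * \<phi>) * cos (real_of_int j * \<phi>)" for \<phi>
    by (simp add: left_diff_distrib distrib_right cos_add cos_diff)
  show ?thesis
    using * by (simp only: **)
qed

private lemma C_eq_bessel_I: "C j = bessel_I j x"
proof -
  let ?f = "\<lambda>m \<phi>. C m * cos (real_of_int m * \<phi>) * cos (real_of_int j * \<phi>)"
  let ?g = "\<lambda>\<phi>. exp (x * cos \<phi>) * cos (real_of_int j * \<phi>)"
  let ?h = "\<lambda>m. pi / 2 * C j * ((if m = j then 1 else 0) + (if m = - j then 1 else 0))"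
  have "uniform_limit {0..pi} (\<lambda>X \<phi>. \<Sum>m\<in>X. ?f m \<phi>) ?g (finite_subsets_at_top UNIV)"
  proof (rule Weierstrass_m_test_general'[OF _ _ C_abs_summable])
    fix m \<phi>
    have "\<bar>C m\<bar> * (\<bar>cos (real_of_int m * \<phi>)\<bar> * \<bar>cos (real_of_int j * \<phi>)\<bar>) \<le> \<bar>C m\<bar> * (1 * 1)"
      by (intro mult_left_mono mult_mono) auto
    then show "norm (?f m \<phi>) \<le> \<bar>C m\<bar>"
      by (simp add: abs_mult mult.assoc)
    show "((\<lambda>m. ?f m \<phi>) has_sum ?g \<phi>) UNIV"
      by (intro has_sum_cmult_left C_cos)
  qed
  then obtain I J where IJ: "\<And>X. ((\<lambda>\<phi>. \<Sum>m\<in>X. ?f m \<phi>) has_integral I X) {0..pi}"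
    "(?g has_integral J) {0..pi}" "(I \<longlongrightarrow> J) (finite_subsets_at_top UNIV)"
    by (rule uniform_limit_integral) (auto intro!: continuous_intros)
  have "I X = (\<Sum>m\<in>X. ?h m)" if "finite X" for X
    by (rule has_integral_unique[OF IJ(1)]) (intro has_integral_sum that cos_cos_integral)
  then have "(?h has_sum J) UNIV"
    unfolding has_sum_def using IJ(3)
    by (auto elim!: Lim_transform_eventually intro!: eventually_finite_subsets_at_top_weakI)
  moreover have "(?h has_sum (pi / 2 * C j * (1 + 1))) UNIV"
  proof (intro has_sum_cmult_right has_sum_add)
    have *: "((\<lambda>m. if m = k then 1 else 0) has_sum (1::real)) UNIV" for k :: int
      by (rule has_sum_finite_neutralI[of "{k}"]) auto
    show "((\<lambda>m. if m = j then 1 else 0) has_sum (1::real)) UNIV"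
      "((\<lambda>m. if m = - j then 1 else 0) has_sum (1::real)) UNIV"
      by (rule *)+
  qed
  ultimately have "J = pi / 2 * C j * (1 + 1)"
    by (rule has_sum_unique)
  moreover have "bessel_I j x = 1 / pi * J"
    unfolding bessel_I_def using integral_unique[OF IJ(2)] by simp
  ultimately show ?thesis by simp
qed

lemma bessel_I_generating_function:
  fixes z :: complex
  assumes "z \<noteq> 0"
  shows "((\<lambda>j. of_real (bessel_I j x) * z powi j) has_sum
           exp (of_real x / 2 * (z + 1 / z))) UNIV"
  using C_generating[OF assms] by (simp add: C_eq_bessel_I)

end

text \<open>
  A tuple in $Z^l$ is given by the values at $0, \dots, l - 1$ of a function on the naturals,
  so the index $i$ here stands for $i + 1$ in the usual numbering of its entries.
  Both HOL-Analysis and Jordan-Normal-Form provide names \<open>mat\<close> and \<open>det\<close>; those of the latter,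
  where the dimension is a term, are meant.
\<close>

definition bessel_det :: "nat \<Rightarrow> (nat \<Rightarrow> int) \<Rightarrow> (nat \<Rightarrow> int) \<Rightarrow> real \<Rightarrow> real" where
  "bessel_det l k n x =
     Determinant.det (Matrix.mat l l (\<lambda>(i, j). bessel_I (k j - n i) x))"

end

theory Submission
  imports Defs
begin

text \<open>
  Fix \<open>k\<close> and write \<open>F n\<close> for the function \<open>bessel_det l k n\<close>. The recurrence
  $I_j' = (I_{j-1} + I_{j+1})/2$, applied to one row of the determinant at a time, gives
  $$F_n' = {\textstyle\frac12} \sum_{i} (F_{n + e_i} + F_{n - e_i}).$$
  If \<open>n\<close> is strictly decreasing, then each $n \pm e_i$ is either strictly decreasing again or has
  two equal entries, and in the latter case two rows of the determinant agree and its term is zero.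
  Hence the functions \<open>F n\<close>, with \<open>n\<close> strictly decreasing, solve a linear system with nonnegative
  coefficients (up to the factor $e^{-lt}$, the backward equations of \<open>l\<close> independent random walks
  killed when two of them meet), and
  $F_n(0)$ is \<open>1\<close> for \<open>n = k\<close> and \<open>0\<close> otherwise.

  The system is infinite, but each equation has at most \<open>2 * l\<close> terms, and all \<open>F n\<close> satisfy
  one common bound on \<open>{0..x}\<close>; this is enough for nonnegative initial values to
  propagate (\<open>nonneg_of_cooperative_system\<close>), so every \<open>F n\<close> is nonnegative on $[0, \infty)$.
  By the differential equation it is then also nondecreasing, so $F_k \geq F_k(0) = 1$.
  Any other \<open>n\<close> can be moved to \<open>k\<close> by unit steps that keep it strictly decreasing
  (\<open>step_towards\<close>), and positivity spreads backwards along these steps: if some neighbour of \<open>n\<close> is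
  positive on $(0, \infty)$, then so is $F_n'$, and hence $F_n$.
\<close>

section \<open>Modified Bessel functions\<close>

text \<open>
  Differentiation under the integral sign produces a factor $\cos\phi$, and
  $2 \cos\phi \cos(j\phi) = \cos((j-1)\phi) + \cos((j+1)\phi)$.
\<close>

lemma bessel_I_has_derivative:
  "(bessel_I j has_real_derivative (bessel_I (j - 1) x + bessel_I (j + 1) x) / 2) (at x)"
proof -
  let ?f = "\<lambda>j x \<phi>. exp (x * cos \<phi>) * cos (real_of_int j * \<phi>)"
  let ?g = "\<lambda>x \<phi>. exp (x * cos \<phi>) * (cos \<phi> * cos (real_of_int j * \<phi>))"
  have int: "?f j x integrable_on {0..pi}" for j x
    by (intro integrable_continuous_real continuous_intros)
  have "((\<lambda>x. integral (cbox 0 pi) (?f j x)) has_real_derivative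
          integral (cbox 0 pi) (?g x)) (at x within UNIV)"
  proof (rule leibniz_rule_field_derivative)
    show "continuous_on (UNIV \<times> cbox 0 pi) (\<lambda>(x, \<phi>). ?g x \<phi>)"
      unfolding case_prod_unfold by (intro continuous_intros)
    show "((\<lambda>x. ?f j x \<phi>) has_real_derivative ?g x \<phi>) (at x within UNIV)" for x \<phi>
      by (auto intro!: derivative_eq_intros)
  qed (use int in auto)
  also have "?g x = (\<lambda>\<phi>. (?f (j - 1) x \<phi> + ?f (j + 1) x \<phi>) / 2)"
    by (rule ext) (simp add: left_diff_distrib distrib_right cos_add cos_diff algebra_simps)
  also have "integral (cbox 0 pi) (\<lambda>\<phi>. (?f (j - 1) x \<phi> + ?f (j + 1) x \<phi>) / 2) =
      (integral {0..pi} (?f (j - 1) x) + integral {0..pi} (?f (j + 1) x)) / 2"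
    by (simp only: integral_divide integral_add[OF int int] cbox_interval)
  finally have "((\<lambda>x. 1 / pi * integral {0..pi} (?f j x)) has_real_derivative
      1 / pi * ((integral {0..pi} (?f (j - 1) x) + integral {0..pi} (?f (j + 1) x)) / 2)) (at x)"
    by (intro DERIV_cmult) simp
  then show ?thesis
    by (simp add: bessel_I_def[abs_def] add_divide_distrib distrib_left)
qed

lemma bessel_I_at_0: "bessel_I j 0 = (if j = 0 then 1 else 0)"
proof (cases "j = 0")
  case False
  have "((\<lambda>\<phi>. cos (real_of_int j * \<phi>)) has_integral
          (sin (real_of_int j * pi) / j - sin (real_of_int j * 0) / j)) {0..pi}"
    using False
    by (intro fundamental_theorem_of_calculus)
       (auto intro!: derivative_eq_intros simp flip: has_real_derivative_iff_has_vector_derivative)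
  then have "integral {0..pi} (\<lambda>\<phi>. cos (real_of_int j * \<phi>)) = 0"
    using sin_npi_int[of j] by (simp add: mult.commute integral_unique)
  then show ?thesis
    using False by (simp add: bessel_I_def)
qed (simp add: bessel_I_def)

lemma abs_bessel_I_le: "\<bar>bessel_I j x\<bar> \<le> exp \<bar>x\<bar>"
proof -
  have "norm (integral {0..pi} (\<lambda>\<phi>. exp (x * cos \<phi>) * cos (real_of_int j * \<phi>))) \<le> exp \<bar>x\<bar> * (pi - 0)"
  proof (rule integral_bound)
    fix \<phi> :: real
    have "x * cos \<phi> \<le> \<bar>x\<bar> * \<bar>cos \<phi>\<bar>"
      by (simp flip: abs_mult)
    also have "\<dots> \<le> \<bar>x\<bar> * 1"
      by (intro mult_left_mono) auto
    finally have "exp (x * cos \<phi>) * \<bar>cos (real_of_int j * \<phi>)\<bar> \<le> exp \<bar>x\<bar> * 1"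
      by (intro mult_mono) auto
    then show "norm (exp (x * cos \<phi>) * cos (real_of_int j * \<phi>)) \<le> exp \<bar>x\<bar>"
      by (simp add: abs_mult)
  qed (auto intro!: continuous_intros)
  then show ?thesis
    by (simp add: bessel_I_def abs_mult field_simps)
qed

section \<open>The determinant as a function of the configuration\<close>

lemma bessel_det_Leibniz:
  "bessel_det l k n x =
     (\<Sum>p | p permutes {..<l}. of_int (sign p) * (\<Prod>i<l. bessel_I (k (p i) - n i) x))"
proof -
  have "(\<Prod>i<l. Matrix.mat l l (\<lambda>(i, j). bessel_I (k j - n i) x) $$ (i, p i)) =
        (\<Prod>i<l. bessel_I (k (p i) - n i) x)" if "p permutes {..<l}" for p
    using that permutes_in_image[OF that] by (intro prod.cong) auto
  then show ?thesis
    unfolding bessel_det_def by (subst Determinant.det_def') (auto simp: atLeast0LessThan)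
qed

text \<open>
  The pair \<open>(i, e)\<close> moves the entry with index \<open>i\<close> by \<open>e\<close>; only \<open>e = 1\<close> and \<open>e = -1\<close> are used.
\<close>

definition step :: "nat \<times> int \<Rightarrow> (nat \<Rightarrow> int) \<Rightarrow> nat \<Rightarrow> int" where
  "step = (\<lambda>(i, e) n. n(i := n i + e))"

text \<open>
  The determinant is linear in each row, and \<open>n i\<close> occurs only in row \<open>i\<close>. So differentiating row
  \<open>i\<close> by the Bessel recurrence replaces the determinant by half the sum of the two in which \<open>n i\<close> is
  shifted by \<open>1\<close> and by \<open>-1\<close>.
\<close>

lemma bessel_det_has_derivative:
  "(bessel_det l k n has_real_derivative
      1 / 2 * (\<Sum>a\<in>{..<l} \<times> {1, -1}. bessel_det l k (step a n) x)) (at x)"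
proof -
  let ?I = "\<lambda>p m i. bessel_I (k (p i) - m i) x"
  let ?P = "{p. p permutes {..<l}}"
  have row: "(bessel_I (k (p i) - n i - 1) x + bessel_I (k (p i) - n i + 1) x) / 2 *
        (\<Prod>j\<in>{..<l} - {i}. ?I p n j) =
      1 / 2 * (\<Sum>e\<in>{1, -1}. \<Prod>j<l. ?I p (step (i, e) n) j)" if "i < l" for p i
  proof -
    have "(\<Prod>j<l. ?I p (step (i, e) n) j) =
        bessel_I (k (p i) - n i - e) x * (\<Prod>j\<in>{..<l} - {i}. ?I p n j)" for e
      using that by (subst prod.remove[of _ i]) (auto simp: step_def algebra_simps intro!: prod.cong)
    then show ?thesis
      by (simp add: field_simps)
  qed
  have "((\<lambda>x. \<Sum>p\<in>?P. of_int (sign p) * (\<Prod>i<l. bessel_I (k (p i) - n i) x)) has_real_derivative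
      (\<Sum>p\<in>?P. of_int (sign p) * (\<Sum>i<l.
        (bessel_I (k (p i) - n i - 1) x + bessel_I (k (p i) - n i + 1) x) / 2 *
        (\<Prod>j\<in>{..<l} - {i}. ?I p n j)))) (at x)"
    by (intro DERIV_sum DERIV_cmult has_field_derivative_prod bessel_I_has_derivative)
  also have "(\<Sum>p\<in>?P. of_int (sign p) * (\<Sum>i<l.
        (bessel_I (k (p i) - n i - 1) x + bessel_I (k (p i) - n i + 1) x) / 2 *
        (\<Prod>j\<in>{..<l} - {i}. ?I p n j))) =
      (\<Sum>p\<in>?P. 1 / 2 * (\<Sum>a\<in>{..<l} \<times> {1, -1}. of_int (sign p) * (\<Prod>j<l. ?I p (step a n) j)))"
  proof (rule sum.cong[OF refl])
    fix p
    have "(\<Sum>i<l. (bessel_I (k (p i) - n i - 1) x + bessel_I (k (p i) - n i + 1) x) / 2 *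
        (\<Prod>j\<in>{..<l} - {i}. ?I p n j)) =
      (\<Sum>i<l. 1 / 2 * (\<Sum>e\<in>{1, -1}. \<Prod>j<l. ?I p (step (i, e) n) j))"
      by (intro sum.cong refl row) auto
    also have "\<dots> = 1 / 2 * (\<Sum>a\<in>{..<l} \<times> {1, -1}. \<Prod>j<l. ?I p (step a n) j)"
      by (simp only: sum.cartesian_product[symmetric] sum_distrib_left[symmetric] case_prod_unfold
          prod.collapse sum.cartesian_product)
    finally show "of_int (sign p) * (\<Sum>i<l. (bessel_I (k (p i) - n i - 1) x +
          bessel_I (k (p i) - n i + 1) x) / 2 * (\<Prod>j\<in>{..<l} - {i}. ?I p n j)) =
      1 / 2 * (\<Sum>a\<in>{..<l} \<times> {1, -1}. of_int (sign p) * (\<Prod>j<l. ?I p (step a n) j))"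
      by (simp only: sum_distrib_left mult.left_commute)
  qed
  also have "\<dots> = 1 / 2 * (\<Sum>a\<in>{..<l} \<times> {1, -1}. bessel_det l k (step a n) x)"
    unfolding bessel_det_Leibniz sum_distrib_left[where r = "1 / 2", symmetric]
    by (subst sum.swap) (rule refl)
  finally show ?thesis
    unfolding bessel_det_Leibniz[abs_def] .
qed

lemma bessel_det_eq_0_if_tie:
  assumes "i < l" "j < l" "i \<noteq> j" "n i = n j"
  shows "bessel_det l k n x = 0"
  unfolding bessel_det_def using assms
  by (intro Determinant.det_identical_rows[of _ l i j]) (auto simp: Matrix.row_def)

text \<open>
  Consecutive entries differ by at least one, so a unit step can make entries equal but cannot
  exchange their order.
\<close>

lemma step_strict_or_tie:
  assumes "strict_antimono_on {..<l} n" "i < l" "e \<in> {1, -1}"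
  shows "strict_antimono_on {..<l} (step (i, e) n) \<or> bessel_det l k (step (i, e) n) x = 0"
proof (rule disjCI)
  assume "bessel_det l k (step (i, e) n) x \<noteq> 0"
  then have "step (i, e) n a \<noteq> step (i, e) n b" if "a < b" "b < l" for a b
    using bessel_det_eq_0_if_tie[of a l b "step (i, e) n"] that by auto
  moreover have "n b < n a" if "a < b" "b < l" for a b
    using assms(1) that by (auto simp: monotone_on_def)
  ultimately show "strict_antimono_on {..<l} (step (i, e) n)"
    using assms(3) unfolding monotone_on_def step_def
    by (smt (verit) fun_upd_apply insertE lessThan_iff old.prod.case singletonD)
qed

text \<open>What matters is that the bound is the same for all configurations \<open>n\<close>.\<close>

lemma abs_bessel_det_le:
  assumes "\<bar>t\<bar> \<le> x"
  shows "\<bar>bessel_det l k n t\<bar> \<le> real (card {p. p permutes {..<l}}) * exp x ^ l"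
proof -
  have "\<bar>bessel_I j t\<bar> \<le> exp x" for j
    using abs_bessel_I_le[of j t] assms by (smt (verit) exp_le_cancel_iff)
  then have "(\<Prod>i<l. \<bar>bessel_I (k (p i) - n i) t\<bar>) \<le> exp x ^ l" for p
    using prod_mono[of "{..<l}" "\<lambda>i. \<bar>bessel_I (k (p i) - n i) t\<bar>" "\<lambda>_. exp x"] by simp
  then have "\<bar>bessel_det l k n t\<bar> \<le> (\<Sum>p | p permutes {..<l}. exp x ^ l)"
    unfolding bessel_det_Leibniz
    by (intro order.trans[OF sum_abs] sum_mono) (simp add: abs_mult abs_prod sign_def)
  then show ?thesis
    by simp
qed

text \<open>
  At \<open>0\<close> the matrix has a one where an entry of \<open>n\<close> equals an entry of \<open>k\<close> and zeros elsewhere, so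
  it is the identity for \<open>n = k\<close>. Two different decreasing tuples of the same length have an
  unmatched entry, which gives a zero row or a zero column.
\<close>

lemma bessel_det_at_0:
  assumes "strict_antimono_on {..<l} k" "strict_antimono_on {..<l} n"
  shows "bessel_det l k n 0 = (if \<forall>i<l. n i = k i then 1 else 0)"
proof (cases "\<forall>i<l. n i = k i")
  case True
  have "k i \<noteq> k j" if "i < l" "j < l" "i \<noteq> j" for i j
    using assms(1) that by (auto simp: monotone_on_def neq_iff)
  with True have "Matrix.mat l l (\<lambda>(i, j). bessel_I (k j - n i) 0) = 1\<^sub>m l"
    by (intro eq_matI) (auto simp: bessel_I_at_0)
  with True show ?thesis
    by (simp add: bessel_det_def)
next
  case False
  then obtain i where i: "i < l" "n i \<noteq> k i" "\<And>j. j < i \<Longrightarrow> n j = k j"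
    using exists_least_iff[of "\<lambda>i. i < l \<and> n i \<noteq> k i"] by (metis order.strict_trans)
  have mono: "k b < k a" "n b < n a" if "a < b" "b < l" for a b
    using assms that by (auto simp: monotone_on_def)
  \<comment> \<open>The larger of the two entries at the first difference does not occur in the other tuple.\<close>
  have vanish: "(\<Prod>i<l. bessel_I (k (p i) - n i) 0) = 0" if p: "p permutes {..<l}" for p
  proof (cases "n i < k i")
    case True
    obtain j where j: "j < l" "p j = i"
      using p i(1) by (metis lessThan_iff permutes_def)
    have "n j \<noteq> k i"
      using True i(3)[of j] mono[of i j] mono[of j i] i(1) j(1) by (cases j i rule: linorder_cases) auto
    with j show ?thesis
      by (auto simp: bessel_I_at_0 intro!: bexI[of _ j])
  next
    case less: False
    have "p i < l"
      using p i(1) by (metis lessThan_iff permutes_in_image)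
    then have "k (p i) \<noteq> n i"
      using less i mono[of i "p i"] mono[of "p i" i] by (cases "p i" i rule: linorder_cases) auto
    with i(1) show ?thesis
      by (auto simp: bessel_I_at_0 intro!: bexI[of _ i])
  qed
  have "bessel_det l k n 0 = 0"
    unfolding bessel_det_Leibniz by (intro sum.neutral) (simp add: vanish)
  with False show ?thesis
    by simp
qed

section \<open>Positivity\<close>

text \<open>
  The bound $F_s(t) \geq -C$ improves itself: inserted in the equation and integrated from \<open>0\<close>,
  it gives $F_s(t) \geq -C K t$ with \<open>K = c * card A\<close>, and after \<open>m\<close> rounds
  $F_s(t) \geq -C (K t)^m / m!$, which tends to \<open>0\<close>. The index set \<open>S\<close> may be infinite, because
  only the number \<open>card A\<close> of terms per equation and the common bound \<open>C\<close> enter.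
\<close>

lemma nonneg_of_cooperative_system:
  fixes F :: "'s \<Rightarrow> real \<Rightarrow> real" and T :: "'a \<Rightarrow> 's \<Rightarrow> 's"
  assumes deriv: "\<And>s t. s \<in> S \<Longrightarrow> 0 \<le> t \<Longrightarrow> t \<le> x \<Longrightarrow>
      (F s has_real_derivative c * (\<Sum>a\<in>A. F (T a s) t)) (at t)"
    and closed: "\<And>s a t. s \<in> S \<Longrightarrow> a \<in> A \<Longrightarrow> T a s \<in> S \<or> F (T a s) t = 0"
    and bound: "\<And>s t. s \<in> S \<Longrightarrow> 0 \<le> t \<Longrightarrow> t \<le> x \<Longrightarrow> \<bar>F s t\<bar> \<le> C"
    and init: "\<And>s. s \<in> S \<Longrightarrow> F s 0 \<ge> 0"
    and "c \<ge> 0" "x \<ge> 0" "s \<in> S"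
  shows "F s x \<ge> 0"
proof -
  define K where "K = c * real (card A)"
  have C: "C \<ge> 0"
    using bound[OF \<open>s \<in> S\<close>, of 0] \<open>x \<ge> 0\<close> by simp
  have K: "K \<ge> 0"
    using \<open>c \<ge> 0\<close> by (simp add: K_def)
  have lower: "F s t \<ge> - C * ((K * t) ^ m / fact m)" if "s \<in> S" "0 \<le> t" "t \<le> x" for s t m
    using that
  proof (induction m arbitrary: s t)
    case 0
    then show ?case using bound[of s t] by simp
  next
    case (Suc m)
    \<comment> \<open>The induction hypothesis at the terms of the equation makes this function nondecreasing.\<close>
    let ?\<phi> = "\<lambda>u. F s u + C * ((K * u) ^ Suc m / fact (Suc m))"
    have "?\<phi> 0 \<le> ?\<phi> t"
    proof (rule DERIV_nonneg_imp_nondecreasing[OF Suc.prems(2)])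
      fix u assume u: "0 \<le> u" "u \<le> t"
      let ?y = "C * ((K * u) ^ m / fact m)"
      have "((\<lambda>u. C * ((K * u) ^ Suc m / fact (Suc m))) has_real_derivative
          C * (real (Suc m) * (K * u) ^ m * K / fact (Suc m))) (at u)"
        by (rule derivative_eq_intros refl | simp)+
      also have "C * (real (Suc m) * (K * u) ^ m * K / fact (Suc m)) = K * ?y"
        by (simp add: field_simps del: of_nat_Suc)
      finally have "(?\<phi> has_real_derivative c * (\<Sum>a\<in>A. F (T a s) u) + K * ?y) (at u)"
        using u Suc.prems by (intro DERIV_add deriv) auto
      moreover have "F (T a s) u \<ge> - ?y" if "a \<in> A" for a
      proof (cases "T a s \<in> S")
        case True
        then show ?thesis using Suc.IH[of "T a s" u] u Suc.prems by simp
      next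
        case False
        then show ?thesis
          using closed[OF \<open>s \<in> S\<close> that, of u] C K u by simp
      qed
      then have "(\<Sum>a\<in>A. F (T a s) u) \<ge> (\<Sum>a\<in>A. - ?y)"
        by (rule sum_mono)
      then have "c * (\<Sum>a\<in>A. F (T a s) u) \<ge> c * (\<Sum>a\<in>A. - ?y)"
        using \<open>c \<ge> 0\<close> by (rule mult_left_mono)
      then have "c * (\<Sum>a\<in>A. F (T a s) u) + K * ?y \<ge> 0"
        by (simp add: K_def mult_ac)
      ultimately show "\<exists>y. DERIV ?\<phi> u :> y \<and> y \<ge> 0"
        by blast
    qed
    with init[OF \<open>s \<in> S\<close>] show ?case
      by simp
  qed
  have "(\<lambda>m. - C * ((K * x) ^ m / fact m)) \<longlonglongrightarrow> - C * 0"
    using summable_LIMSEQ_zero[OF summable_exp[of "K * x"]]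
    by (intro tendsto_mult_left) (simp add: field_simps)
  then show ?thesis
    using lower[OF \<open>s \<in> S\<close> \<open>x \<ge> 0\<close>] by (intro LIMSEQ_le_const2) auto
qed

lemma bessel_det_nonneg:
  assumes "strict_antimono_on {..<l} k" "strict_antimono_on {..<l} n" "x \<ge> 0"
  shows "bessel_det l k n x \<ge> 0"
proof (rule nonneg_of_cooperative_system
    [where F = "bessel_det l k" and c = "1 / 2" and S = "{n. strict_antimono_on {..<l} n}"])
  show "step a s \<in> {n. strict_antimono_on {..<l} n} \<or> bessel_det l k (step a s) t = 0"
    if "s \<in> {n. strict_antimono_on {..<l} n}" "a \<in> {..<l} \<times> {1, -1}" for s a t
    using that step_strict_or_tie[of l s "fst a" "snd a" k t] by auto
  show "(bessel_det l k s has_real_derivative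
      1 / 2 * (\<Sum>a\<in>{..<l} \<times> {1, -1}. bessel_det l k (step a s) t)) (at t)" for s t
    by (rule bessel_det_has_derivative)
qed (use assms in \<open>auto intro!: abs_bessel_det_le simp: bessel_det_at_0\<close>)

text \<open>
  If some entry of \<open>n\<close> is too small, the first such entry can be raised, since the entry before it
  is at least the corresponding entry of \<open>k\<close> and so leaves room. Otherwise the last entry that is
  too large can be lowered, since all later ones already agree with those of \<open>k\<close>.
\<close>

lemma step_towards:
  assumes k: "strict_antimono_on {..<l} k" and n: "strict_antimono_on {..<l} n"
    and "\<not> (\<forall>i<l. n i = k i)"
  obtains i e where "i < l" "e \<in> {1, -1}" "strict_antimono_on {..<l} (step (i, e) n)"
    "\<bar>step (i, e) n i - k i\<bar> < \<bar>n i - k i\<bar>"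
proof (cases "\<exists>i<l. n i < k i")
  case True
  then obtain i where i: "i < l" "n i < k i" "\<And>j. j < i \<Longrightarrow> n j \<ge> k j"
    using exists_least_iff[of "\<lambda>i. i < l \<and> n i < k i"] by (metis order.strict_trans not_less)
  have "n i + 1 < n j" if "j < i" for j
    using i(2) i(3)[OF that] k that i(1) by (force simp: monotone_on_def)
  then have "strict_antimono_on {..<l} (step (i, 1) n)"
    using n by (fastforce simp: monotone_on_def step_def)
  then show ?thesis
    using that[of i 1] i by (simp add: step_def)
next
  case False
  let ?D = "{i. i < l \<and> n i > k i}"
  define i where "i = Max ?D"
  have "?D \<noteq> {}"
    using False assms(3) by force
  then have i: "i < l" "n i > k i" and max: "\<And>j. j < l \<Longrightarrow> n j > k j \<Longrightarrow> j \<le> i"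
    using Max_in[of ?D] by (auto simp: i_def)
  have "n j < n i - 1" if "i < j" "j < l" for j
    using max[OF that(2)] i k that by (force simp: monotone_on_def)
  then have "strict_antimono_on {..<l} (step (i, -1) n)"
    using n by (fastforce simp: monotone_on_def step_def)
  then show ?thesis
    using that[of i "-1"] i by (simp add: step_def)
qed

theorem theorem1p3:
  fixes l :: nat and k n :: "nat \<Rightarrow> int" and x :: real
  assumes "l \<ge> 1"
    and "strict_antimono_on {..<l} k"
    and "strict_antimono_on {..<l} n"
    and "x > 0"
  shows "bessel_det l k n x > 0"
  using assms(3,4)
  \<comment> \<open>The argument \<open>x\<close> is generalised because positivity of a neighbour is needed on all of \<open>{0<..<x}\<close>.\<close>
proof (induction "\<Sum>i<l. nat \<bar>n i - k i\<bar>" arbitrary: n x rule: less_induct)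
  case less
  let ?G = "\<lambda>t. \<Sum>a\<in>{..<l} \<times> {1, -1}. bessel_det l k (step a n) t"
  have term_nonneg: "bessel_det l k (step a n) t \<ge> 0" if "a \<in> {..<l} \<times> {1, -1}" "t \<ge> 0" for a t
    using that step_strict_or_tie[OF less.prems(1), of "fst a" "snd a" k t]
      bessel_det_nonneg[OF assms(2), of "step a n" t] by auto
  show ?case
  proof (cases "\<forall>i<l. n i = k i")
    case True
    have "bessel_det l k n 0 \<le> bessel_det l k n x"
    proof (rule DERIV_nonneg_imp_nondecreasing[where f = "bessel_det l k n"])
      fix t :: real assume t: "0 \<le> t" "t \<le> x"
      then have "?G t \<ge> 0"
        by (intro sum_nonneg term_nonneg) auto
      then show "\<exists>y. (bessel_det l k n has_real_derivative y) (at t) \<and> y \<ge> 0"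
        by (intro exI[of _ "1 / 2 * ?G t"] conjI bessel_det_has_derivative) simp
    qed (use less.prems(2) in simp)
    with True show ?thesis
      by (simp add: bessel_det_at_0[OF assms(2) less.prems(1)])
  next
    case False
    then obtain i e where ie: "i < l" "e \<in> {1, -1}" "strict_antimono_on {..<l} (step (i, e) n)"
      "\<bar>step (i, e) n i - k i\<bar> < \<bar>n i - k i\<bar>"
      using step_towards[OF assms(2) less.prems(1)] by metis
    have closer: "(\<Sum>j<l. nat \<bar>step (i, e) n j - k j\<bar>) < (\<Sum>j<l. nat \<bar>n j - k j\<bar>)"
    proof (rule sum_strict_mono_ex1)
      show "\<forall>j\<in>{..<l}. nat \<bar>step (i, e) n j - k j\<bar> \<le> nat \<bar>n j - k j\<bar>"
        using ie(4) by (auto simp: step_def)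
      show "\<exists>j\<in>{..<l}. nat \<bar>step (i, e) n j - k j\<bar> < nat \<bar>n j - k j\<bar>"
        using ie(1,4) by (intro bexI[of _ i]) auto
    qed simp
    \<comment> \<open>The derivative may vanish at \<open>0\<close>, so only the open interval is used.\<close>
    have "bessel_det l k n 0 < bessel_det l k n x"
    proof (rule DERIV_pos_imp_increasing_open[where f = "bessel_det l k n", OF less.prems(2)])
      fix t :: real assume t: "0 < t" "t < x"
      have "?G t > 0"
        using less.hyps[OF closer ie(3) t(1)] ie(1,2) t term_nonneg
        by (intro sum_pos2[where i = "(i, e)"]) auto
      then show "\<exists>y. (bessel_det l k n has_real_derivative y) (at t) \<and> y > 0"
        by (intro exI[of _ "1 / 2 * ?G t"] conjI bessel_det_has_derivative) simp
    next
      show "continuous_on {0..x} (bessel_det l k n)"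
        by (intro DERIV_continuous_on) (rule DERIV_subset[OF bessel_det_has_derivative], simp)
    qed
    with False show ?thesis
      by (simp add: bessel_det_at_0[OF assms(2) less.prems(1)] split: if_splits)
  qed
qed

end
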